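(* Let $X$ be a non-negative absolutely continuous random variable with probability density function $f$ satisfying $$e^{-(\alpha x+\beta)}\le f(x)\le 1,\qquad x>0,$$ for some $\alpha>0$ and $\beta\ge 0$. Then the weighted varentropy of $X$ with weight $w(x)=x$ satisfies $$VE^{x}(X)\le H^{w_2}(X),$$ where $H^{w_2}(X)$ is the weighted Shannon entropy of $X$ with weight function $w_2(x)=\alpha x^3+\beta x^2$.
   Context: For a non-negative absolutely continuous random variable $X$ with density $f$ and a weight function $w\ge 0$, the weighted Shannon entropy is $H^{w}(X)=-\int_0^\infty w(x)f(x)\log f(x)\,dx$, and the weighted varentropy is $$VE^{w}(X)=\mathrm{Var}[-w(X)\log f(X)]=\int_0^\infty w^2(x)f(x)[\log f(x)]^2dx-\Big[\int_0^\infty w(x)f(x)\log f(x)\,dx\Big]^2.$$ $VE^{x}(X)$ denotes the weighted varentropy with the identity weight $w(x)=x$. Here $\log$ is the natural logarithm. *)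

theory Defs
  imports "HOL-Probability.Probability"
begin

text \<open>
  No integrability is assumed for the functionals below, so they take values in the extended
  reals; the Bochner integral would silently return 0 for a divergent integral.
  The integral over the positive half-line is the integral of the positive part minus that of
  the negative part. On \<open>ereal\<close> one has \<open>\<infinity> - \<infinity> = \<infinity>\<close>, so the value of this is
  meaningful only when at least one of the two parts has a finite integral.
\<close>

definition ext_integral :: "(real \<Rightarrow> real) \<Rightarrow> ereal" where
  "ext_integral g =
     enn2ereal (\<integral>\<^sup>+x\<in>{0<..}. ennreal (g x) \<partial>lborel) - enn2ereal (\<integral>\<^sup>+x\<in>{0<..}. ennreal (- g x) \<partial>lborel)"

definition weighted_entropy :: "(real \<Rightarrow> real) \<Rightarrow> (real \<Rightarrow> real) \<Rightarrow> ereal" where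
  "weighted_entropy w f = - ext_integral (\<lambda>x. w x * f x * ln (f x))"

text \<open>
  If the second moment is infinite, the difference below is \<open>\<infinity>\<close>, whatever the first moment is;
  this is the usual convention for the variance of a variable that is not square-integrable.
\<close>

definition weighted_varentropy :: "(real \<Rightarrow> real) \<Rightarrow> (real \<Rightarrow> real) \<Rightarrow> ereal" where
  "weighted_varentropy w f =
     ext_integral (\<lambda>x. (w x)\<^sup>2 * f x * (ln (f x))\<^sup>2) - (ext_integral (\<lambda>x. w x * f x * ln (f x)))\<^sup>2"

lemma ext_integral_eq_set_integral:
  assumes "set_integrable lborel {0<..} g"
  shows "ext_integral g = ereal (LINT x:{0<..}|lborel. g x)"
proof -
  let ?h = "\<lambda>x. indicator {0<..} x *\<^sub>R g x"
  have i: "integrable lborel ?h"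
    using assms by (simp add: set_integrable_def)
  have p: "(\<integral>\<^sup>+x\<in>{0<..}. ennreal (g x) \<partial>lborel) = (\<integral>\<^sup>+x. ennreal (?h x) \<partial>lborel)"
    by (intro nn_integral_cong) (auto simp: indicator_def)
  have n: "(\<integral>\<^sup>+x\<in>{0<..}. ennreal (- g x) \<partial>lborel) = (\<integral>\<^sup>+x. ennreal (- ?h x) \<partial>lborel)"
    by (intro nn_integral_cong) (auto simp: indicator_def)
  have fin: "(\<integral>\<^sup>+x. ennreal (?h x) \<partial>lborel) \<noteq> \<infinity>" "(\<integral>\<^sup>+x. ennreal (- ?h x) \<partial>lborel) \<noteq> \<infinity>"
    using i by (auto simp: real_integrable_def)
  have "ext_integral g = ereal (enn2real (\<integral>\<^sup>+x. ennreal (?h x) \<partial>lborel)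
      - enn2real (\<integral>\<^sup>+x. ennreal (- ?h x) \<partial>lborel))"
    unfolding ext_integral_def p n
    using fin by (cases "\<integral>\<^sup>+x. ennreal (?h x) \<partial>lborel"; cases "\<integral>\<^sup>+x. ennreal (- ?h x) \<partial>lborel") auto
  also have "\<dots> = ereal (LINT x:{0<..}|lborel. g x)"
    unfolding set_lebesgue_integral_def by (simp only: real_lebesgue_integral_def[OF i])
  finally show ?thesis .
qed

lemma (in prob_space) weighted_varentropy_eq_variance:
  fixes X :: "'a \<Rightarrow> real" and f w :: "real \<Rightarrow> real"
  assumes X: "distributed M lborel X (\<lambda>x. ennreal (f x))"
    and f: "\<And>x. 0 \<le> f x" and nonneg: "AE \<omega> in M. 0 \<le> X \<omega>"
    and w[measurable]: "w \<in> borel_measurable borel"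
    and sq: "integrable M (\<lambda>\<omega>. (- w (X \<omega>) * ln (f (X \<omega>)))\<^sup>2)"
  shows "weighted_varentropy w f = ereal (variance (\<lambda>\<omega>. - w (X \<omega>) * ln (f (X \<omega>))))"
proof -
  define Y where "Y = (\<lambda>x. - w x * ln (f x))"
  have fm[measurable]: "f \<in> borel_measurable borel"
    using distributed_real_measurable[OF _ X] f by simp
  have Xm[measurable]: "X \<in> borel_measurable M"
    using distributed_measurable[OF X] by simp
  have Ym[measurable]: "Y \<in> borel_measurable borel"
    unfolding Y_def by measurable
  have i2: "integrable M (\<lambda>\<omega>. (Y (X \<omega>))\<^sup>2)"
    using sq by (simp add: Y_def)
  have i1: "integrable M (\<lambda>\<omega>. Y (X \<omega>))"
    by (rule square_integrable_imp_integrable[OF _ i2]) measurable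
  have "AE x in distr M lborel X. 0 \<le> x"
    using nonneg by (subst AE_distr_iff) auto
  then have "AE x in density lborel (\<lambda>x. ennreal (f x)). 0 \<le> x"
    unfolding distributed_distr_eq_density[OF X] .
  then have "AE x in lborel. 0 < f x \<longrightarrow> 0 \<le> x"
    by (subst (asm) AE_density) auto
  moreover have "AE x in lborel. x \<noteq> (0::real)"
    by (rule AE_lborel_singleton)
  ultimately have f0: "AE x in lborel. x \<notin> {0<..} \<longrightarrow> f x = 0"
    by eventually_elim (use f in \<open>force simp: order_less_le\<close>)
  have half: "set_integrable lborel {0<..} (\<lambda>x. f x * g x) \<and>
      (LINT x:{0<..}|lborel. f x * g x) = expectation (\<lambda>\<omega>. g (X \<omega>))"
    if [measurable]: "g \<in> borel_measurable borel" and i: "integrable M (\<lambda>\<omega>. g (X \<omega>))" for g :: "real \<Rightarrow> real"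
  proof -
    have ae: "AE x in lborel. f x * g x = indicator {0<..} x *\<^sub>R (f x * g x)"
      using f0 by eventually_elim (auto simp: indicator_def)
    have "integrable lborel (\<lambda>x. f x * g x)"
      using i distributed_integrable[OF X, of g] f by simp
    then have "set_integrable lborel {0<..} (\<lambda>x. f x * g x)"
      unfolding set_integrable_def by (subst integrable_cong_AE[symmetric, OF _ _ ae]) auto
    moreover have "(LINT x:{0<..}|lborel. f x * g x) = (LINT x|lborel. f x * g x)"
      unfolding set_lebesgue_integral_def by (subst integral_cong_AE[OF _ _ ae]) auto
    moreover have "\<dots> = expectation (\<lambda>\<omega>. g (X \<omega>))"
      using distributed_integral[OF X, of g] f by simp
    ultimately show ?thesis by simp
  qed
  have 1: "ext_integral (\<lambda>x. w x * f x * ln (f x)) = ereal (- expectation (\<lambda>\<omega>. Y (X \<omega>)))"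
  proof -
    have "(\<lambda>x. w x * f x * ln (f x)) = (\<lambda>x. f x * - Y x)"
      by (auto simp: Y_def)
    then show ?thesis
      using half[of "\<lambda>x. - Y x"] i1 by (simp add: ext_integral_eq_set_integral)
  qed
  have 2: "ext_integral (\<lambda>x. (w x)\<^sup>2 * f x * (ln (f x))\<^sup>2) = ereal (expectation (\<lambda>\<omega>. (Y (X \<omega>))\<^sup>2))"
  proof -
    have "(\<lambda>x. (w x)\<^sup>2 * f x * (ln (f x))\<^sup>2) = (\<lambda>x. f x * (Y x)\<^sup>2)"
      by (auto simp: Y_def power_mult_distrib)
    then show ?thesis
      using half[of "\<lambda>x. (Y x)\<^sup>2"] i2 by (simp add: ext_integral_eq_set_integral)
  qed
  show ?thesis
    unfolding weighted_varentropy_def 1 2 using variance_eq[OF i1 i2] by (simp add: Y_def)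
qed

end

theory Submission imports Defs begin

text \<open>
  The bounds on \<open>f\<close> say that \<open>0 \<le> - ln (f x) \<le> \<alpha> * x + \<beta>\<close>. Hence the integrand of the second
  moment of \<open>- x * ln (f x)\<close> is at most the integrand of the weighted entropy, and the variance is at
  most the second moment. All integrals involved are well defined in the extended reals because their
  integrands have constant sign, so integrability plays no role.
\<close>

lemma ext_integral_nonneg_eq:
  assumes "\<And>x. x > 0 \<Longrightarrow> 0 \<le> g x"
  shows "ext_integral g = enn2ereal (\<integral>\<^sup>+x\<in>{0<..}. ennreal (g x) \<partial>lborel)"
proof -
  have "(\<lambda>x. ennreal (- g x) * indicator {0<..} x) = (\<lambda>x. 0)"
    using assms by (auto simp: fun_eq_iff indicator_def ennreal_neg)
  then show ?thesis
    by (simp add: ext_integral_def zero_ennreal.rep_eq)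
qed

lemma ext_integral_nonpos_eq:
  assumes "\<And>x. x > 0 \<Longrightarrow> g x \<le> 0"
  shows "ext_integral g = - enn2ereal (\<integral>\<^sup>+x\<in>{0<..}. ennreal (- g x) \<partial>lborel)"
proof -
  have "(\<lambda>x. ennreal (g x) * indicator {0<..} x) = (\<lambda>x. 0)"
    using assms by (auto simp: fun_eq_iff indicator_def ennreal_neg)
  then show ?thesis
    by (simp add: ext_integral_def zero_ennreal.rep_eq)
qed

text \<open>Squares in \<open>ereal\<close> are nonnegative, so subtracting one cannot increase a
  value. The convention \<open>\<infinity> - \<infinity> = \<infinity>\<close> does no harm, as the
  right-hand side is then \<open>\<infinity>\<close> too.\<close>

lemma weighted_varentropy_le_second_moment:
  "weighted_varentropy w f \<le> ext_integral (\<lambda>x. (w x)\<^sup>2 * f x * (ln (f x))\<^sup>2)"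
proof -
  have "a - b\<^sup>2 \<le> a" for a b :: ereal
    by (cases a; cases b) (auto simp: power2_eq_square)
  then show ?thesis
    unfolding weighted_varentropy_def .
qed

theorem proposition2p2:
  fixes M :: "'a measure" and X :: "'a \<Rightarrow> real" and f :: "real \<Rightarrow> real" and \<alpha> \<beta> :: real
  assumes "prob_space M"
    and "distributed M lborel X (\<lambda>x. ennreal (f x))"
    and "\<And>x. 0 \<le> f x"
    and "AE \<omega> in M. 0 \<le> X \<omega>"
    and "\<alpha> > 0" and "\<beta> \<ge> 0"
    and "\<And>x. x > 0 \<Longrightarrow> exp (- (\<alpha> * x + \<beta>)) \<le> f x \<and> f x \<le> 1"
  shows "weighted_varentropy (\<lambda>x. x) f \<le> weighted_entropy (\<lambda>x. \<alpha> * x ^ 3 + \<beta> * x\<^sup>2) f"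
proof -
  let ?w = "\<lambda>x. \<alpha> * x ^ 3 + \<beta> * x\<^sup>2"
  have ln_bounds: "0 \<le> - ln (f x)" "- ln (f x) \<le> \<alpha> * x + \<beta>" if "x > 0" for x
  proof -
    have b: "exp (- (\<alpha> * x + \<beta>)) \<le> f x" "f x \<le> 1"
      using assms(7)[OF that] by auto
    then have pos: "0 < f x"
      by (metis exp_gt_zero less_le_trans)
    show "0 \<le> - ln (f x)"
      using pos b(2) by simp
    show "- ln (f x) \<le> \<alpha> * x + \<beta>"
      using b(1) unfolding ln_ge_iff[OF pos, symmetric] by linarith
  qed
  have pointwise: "x\<^sup>2 * f x * (ln (f x))\<^sup>2 \<le> - (?w x * f x * ln (f x))" if "x > 0" for x
  proof -
    \<comment> \<open>Only one of the two factors \<open>- ln (f x)\<close> is replaced by its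
      bound; the other supplies the logarithm of the entropy, and
      \<open>x\<^sup>2 * (\<alpha> * x + \<beta>)\<close> is the weight \<open>?w x\<close>.\<close>
    have "x\<^sup>2 * f x * (- ln (f x)) * (- ln (f x)) \<le> x\<^sup>2 * f x * (- ln (f x)) * (\<alpha> * x + \<beta>)"
      using ln_bounds[OF that] assms(3) by (intro mult_left_mono mult_nonneg_nonneg) auto
    then show ?thesis
      by (simp add: power2_eq_square power3_eq_cube algebra_simps)
  qed
  have "ext_integral (\<lambda>x. x\<^sup>2 * f x * (ln (f x))\<^sup>2) =
      enn2ereal (\<integral>\<^sup>+x\<in>{0<..}. ennreal (x\<^sup>2 * f x * (ln (f x))\<^sup>2) \<partial>lborel)"
    using assms(3) by (intro ext_integral_nonneg_eq) simp
  also have "\<dots> \<le> enn2ereal (\<integral>\<^sup>+x\<in>{0<..}. ennreal (- (?w x * f x * ln (f x))) \<partial>lborel)"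
    \<comment> \<open>The order on \<open>ennreal\<close> is inherited from \<open>ereal\<close>, so
      the comparison can be made between nonnegative integrals.\<close>
    unfolding less_eq_ennreal.rep_eq[symmetric]
    by (intro nn_integral_mono) (auto simp del: mult_minus_left simp: indicator_def intro!: ennreal_leI pointwise)
  also have "\<dots> = weighted_entropy ?w f"
  proof -
    have "?w x * f x * ln (f x) \<le> 0" if "x > 0" for x
      using ln_bounds[OF that] assms(3,5,6) that
      by (intro mult_nonneg_nonpos mult_nonneg_nonneg add_nonneg_nonneg) auto
    \<comment> \<open>The minus sign in \<open>weighted_entropy\<close> cancels the one from
      \<open>ext_integral_nonpos_eq\<close>.\<close>
    then show ?thesis
      unfolding weighted_entropy_def by (subst ext_integral_nonpos_eq) simp_all
  qed
  finally show ?thesis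
    by (rule order_trans[OF weighted_varentropy_le_second_moment])
qed

end
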